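(* Let $n\ge 2$, let $r_1,\dots,r_n\ge 2$ be integers, and let $G=H_n=H_n(r_1,\dots,r_n)=K_{r_1}\square\cdots\square K_{r_n}$. Then: \begin{itemize} \item If $S$ is a Carathéodory set of $G$ of maximum cardinality such that $\dim(G[\mathcal H(S)])=n$, then $S$ is a minimal hull set of $G$. \item $c(H_n)\le p(H_n)$. \end{itemize}
   Context: All graphs are finite, simple and undirected. $K_r$ is the complete graph on $\{0,\dots,r-1\}$. The Hamming graph $H_n(r_1,\dots,r_n)=K_{r_1}\square\cdots\square K_{r_n}$ has as vertices the tuples $(x_1,\dots,x_n)$ with $0\le x_i\le r_i-1$; two vertices are adjacent iff they differ in exactly one coordinate. $G[X]$ is the subgraph of $G$ induced by $X$. A set $S\subseteq V(G)$ is $P_3$-convex if every vertex of $V(G)\setminus S$ has at most one neighbor in $S$. The $P_3$-hull $\mathcal H(S)$ of $S\subseteq V(G)$ is the smallest $P_3$-convex set of $G$ containing $S$. The boundary is $\partial\mathcal H(S)=\mathcal H(S)\setminus\bigcup_{u\in S}\mathcal H(S\setminus\{u\})$, and $S$ is a Carathéodory set of $G$ if $\partial\mathcal H(S)\neq\emptyset$. The Carathéodory number $c(G)$ is the smallest integer $c$ such that for every $S\subseteq V(G)$ and $p\in\mathcal H(S)$ there is $F\subseteq S$ with $|F|\le c$ and $p\in\mathcal H(F)$; equivalently, it is the largest cardinality of a Carathéodory set of $G$. A minimal hull set of $G$ is a set $S\subseteq V(G)$ with $\mathcal H(S)=V(G)$ and $\mathcal H(R)\subsetneq V(G)$ for every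 proper subset $R$ of $S$; $p(G)$ is the maximum cardinality of a minimal hull set of $G$. A Hamming subgraph of $H_n$ is a subgraph induced by the set of all vertices having prescribed values on some (possibly empty) set of coordinates; its dimension $\dim$ is the number of coordinates that are not prescribed (so a single vertex has dimension $0$ and $H_n$ has dimension $n$). For a Carathéodory set $S$ of $H_n$ the hull $\mathcal H(S)$ induces a connected subgraph, which is a Hamming subgraph, so $\dim(G[\mathcal H(S)])$ is defined. *)

theory Defs
  imports Complex_Main "HOL.Hull" "HOL-Library.FuncSet"
begin

record 'a graph =
  verts :: "'a set"
  edges :: "'a set set"

definition nbrs :: "'a graph \<Rightarrow> 'a \<Rightarrow> 'a set" where
  "nbrs G v = {u \<in> verts G. {u, v} \<in> edges G}"

definition induced_subgraph :: "'a graph \<Rightarrow> 'a set \<Rightarrow> 'a graph" where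
  "induced_subgraph G X = \<lparr>verts = X, edges = {e \<in> edges G. e \<subseteq> X}\<rparr>"

definition p3_convex :: "'a graph \<Rightarrow> 'a set \<Rightarrow> bool" where
  "p3_convex G S \<longleftrightarrow> S \<subseteq> verts G \<and> (\<forall>v \<in> verts G - S. card (nbrs G v \<inter> S) \<le> 1)"

definition p3_hull :: "'a graph \<Rightarrow> 'a set \<Rightarrow> 'a set" where
  "p3_hull G S = p3_convex G hull S"

definition hull_boundary :: "'a graph \<Rightarrow> 'a set \<Rightarrow> 'a set" where
  "hull_boundary G S = p3_hull G S - (\<Union>u\<in>S. p3_hull G (S - {u}))"

definition caratheodory_set :: "'a graph \<Rightarrow> 'a set \<Rightarrow> bool" where
  "caratheodory_set G S \<longleftrightarrow> S \<subseteq> verts G \<and> hull_boundary G S \<noteq> {}"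

definition caratheodory_number :: "'a graph \<Rightarrow> nat" where
  "caratheodory_number G =
     (LEAST c. \<forall>S p. S \<subseteq> verts G \<longrightarrow> p \<in> p3_hull G S \<longrightarrow>
        (\<exists>F. F \<subseteq> S \<and> card F \<le> c \<and> p \<in> p3_hull G F))"

definition minimal_hull_set :: "'a graph \<Rightarrow> 'a set \<Rightarrow> bool" where
  "minimal_hull_set G S \<longleftrightarrow>
     S \<subseteq> verts G \<and> p3_hull G S = verts G \<and> (\<forall>R. R \<subset> S \<longrightarrow> p3_hull G R \<subset> verts G)"

definition max_minimal_hull_set :: "'a graph \<Rightarrow> nat" where
  "max_minimal_hull_set G = Max {card S | S. minimal_hull_set G S}"

text \<open>
  A vertex \<open>(x\<^sub>1, \<dots>, x\<^sub>n)\<close> of the Hamming graph is an extensional function on \<open>{1..n}\<close>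
  (undefined outside \<open>{1..n}\<close>), so that equality of functions is equality of tuples.
\<close>

definition hamming_graph :: "nat \<Rightarrow> (nat \<Rightarrow> nat) \<Rightarrow> (nat \<Rightarrow> nat) graph" where
  "hamming_graph n r =
     (let V = (\<Pi>\<^sub>E i\<in>{1..n}. {0..<r i})
      in \<lparr>verts = V,
          edges = {{x, y} | x y. x \<in> V \<and> y \<in> V \<and> card {i \<in> {1..n}. x i \<noteq> y i} = 1}\<rparr>)"

definition hamming_subgraph ::
  "nat \<Rightarrow> (nat \<Rightarrow> nat) \<Rightarrow> nat set \<Rightarrow> (nat \<Rightarrow> nat) \<Rightarrow> (nat \<Rightarrow> nat) graph" where
  "hamming_subgraph n r I a =
     induced_subgraph (hamming_graph n r) {x \<in> verts (hamming_graph n r). \<forall>i\<in>I. x i = a i}"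

text \<open>
  The dimension of a Hamming subgraph of \<open>hamming_graph n r\<close>. It is well defined when every
  \<open>r i\<close> is at least 2, since then the set \<open>I\<close> of prescribed coordinates is determined by the
  subgraph. The value is unspecified for graphs that are not Hamming subgraphs.
\<close>

definition hamming_dim :: "nat \<Rightarrow> (nat \<Rightarrow> nat) \<Rightarrow> (nat \<Rightarrow> nat) graph \<Rightarrow> nat" where
  "hamming_dim n r H =
     (THE d. \<exists>I a. I \<subseteq> {1..n} \<and> (\<forall>i\<in>I. a i < r i) \<and>
        H = hamming_subgraph n r I a \<and> d = card ({1..n} - I))"

definition hull_dim :: "nat \<Rightarrow> (nat \<Rightarrow> nat) \<Rightarrow> (nat \<Rightarrow> nat) set \<Rightarrow> nat" where
  "hull_dim n r S =
     hamming_dim n r (induced_subgraph (hamming_graph n r) (p3_hull (hamming_graph n r) S))"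

end

theory Submission
  imports Defs
begin

text \<open>
  The two claims rest on one structural fact and one construction.

  Suppose that \<open>p\<close> lies in the hull of \<open>F\<close> but in no hull of \<open>F\<close> with an element removed. Then
  the hull of \<open>F\<close> is the vertex set of a Hamming subgraph, called a cylinder below
  (\<open>hull_eq_cyl\<close>). The reason is that a largest cylinder through \<open>p\<close> inside the hull has no
  neighbour in the rest of the hull, so the elements of \<open>F\<close> outside it cannot help to generate
  \<open>p\<close>. A Caratheodory set whose hull has dimension \<open>n\<close> therefore has the whole vertex set as
  its hull, and a boundary point witnesses that no element can be dropped: it is a minimal hull
  set. This settles the first claim.

  For the second claim, take \<open>p\<close> in the hull of some set and let \<open>F\<close> be a smallest subset
  with \<open>p\<close> in its hull. The hull of \<open>F\<close> is a cylinder and \<open>F\<close> is irredundant, so it is enough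
  to turn an irredundant set \<open>S\<close> generating a cylinder into one that is no smaller and generates
  the cylinder with one more free coordinate \<open>i\<close> (\<open>irredundant_lift\<close>), and to iterate. To do so,
  pick \<open>u \<in> S\<close> and let \<open>u'\<close> be \<open>u\<close> with a new value at \<open>i\<close>.

  If \<open>u\<close> has a neighbour in the hull of \<open>S - {u}\<close>, replace \<open>u\<close> by \<open>u'\<close>. That neighbour and
  \<open>u'\<close> are two neighbours of \<open>u\<close>, so \<open>u\<close> is regained, and with it the old cylinder together with
  a point next to it, which spans the larger cylinder. Otherwise add \<open>u'\<close> to \<open>S\<close>. Now \<open>u\<close>
  cannot be dropped, because \<open>u'\<close> is at distance at least 3 from the hull of \<open>S - {u}\<close> and so
  generates nothing with it. In both cases, dropping any other element of \<open>S\<close> is seen to fail by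
  projecting along coordinate \<open>i\<close>, and dropping \<open>u'\<close> leaves a subset of the old cylinder.
\<close>

section \<open>Convexity in finite graphs\<close>

lemma p3_convex_iff:
  assumes "finite (verts G)"
  shows "p3_convex G S \<longleftrightarrow> S \<subseteq> verts G \<and>
    (\<forall>v\<in>verts G. \<forall>x\<in>nbrs G v \<inter> S. \<forall>y\<in>nbrs G v \<inter> S. x \<noteq> y \<longrightarrow> v \<in> S)"
proof -
  have fin: "finite (nbrs G v \<inter> S)" for v
    using assms by (auto simp: nbrs_def)
  show ?thesis
    unfolding p3_convex_def One_nat_def card_le_Suc0_iff_eq[OF fin] by blast
qed

lemma subset_p3_hull: "S \<subseteq> p3_hull G S"
  unfolding p3_hull_def by (rule hull_subset)

lemma p3_hull_mono: "S \<subseteq> T \<Longrightarrow> p3_hull G S \<subseteq> p3_hull G T"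
  unfolding p3_hull_def by (rule hull_mono)

lemma p3_hull_subset: "S \<subseteq> C \<Longrightarrow> p3_convex G C \<Longrightarrow> p3_hull G S \<subseteq> C"
  unfolding p3_hull_def by (rule hull_minimal)

lemma p3_convex_verts: "p3_convex G (verts G)"
  by (simp add: p3_convex_def)

lemma p3_hull_empty: "p3_hull G {} = {}"
  using p3_hull_subset[of "{}" "{}" G] by (simp add: p3_convex_def)

lemma p3_convex_p3_hull:
  assumes fin: "finite (verts G)" and "S \<subseteq> verts G"
  shows "p3_convex G (p3_hull G S)"
proof -
  have sub: "p3_hull G S \<subseteq> verts G"
    using assms(2) p3_convex_verts by (rule p3_hull_subset)
  have "v \<in> p3_hull G S" if v: "v \<in> verts G" "x \<noteq> y"
      "x \<in> nbrs G v" "y \<in> nbrs G v" "x \<in> p3_hull G S" "y \<in> p3_hull G S" for v x y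
    unfolding p3_hull_def hull_def
  proof clarify
    fix C assume C: "p3_convex G C" "S \<subseteq> C"
    then have "x \<in> C" "y \<in> C" using v p3_hull_subset[of S C G] by auto
    then show "v \<in> C" using v C p3_convex_iff[OF fin, of C] by blast
  qed
  then show ?thesis using sub p3_convex_iff[OF fin] by auto
qed

lemma p3_convexD:
  assumes "finite (verts G)" "p3_convex G C" "v \<in> verts G" "x \<in> nbrs G v" "y \<in> nbrs G v"
    "x \<in> C" "y \<in> C" "x \<noteq> y"
  shows "v \<in> C"
  using assms p3_convex_iff[of G C] by blast

lemma p3_convexI:
  assumes "finite (verts G)" "C \<subseteq> verts G"
    "\<And>v x y. v \<in> verts G \<Longrightarrow> v \<notin> C \<Longrightarrow> x \<in> nbrs G v \<Longrightarrow> y \<in> nbrs G v \<Longrightarrow>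
      x \<in> C \<Longrightarrow> y \<in> C \<Longrightarrow> x \<noteq> y \<Longrightarrow> False"
  shows "p3_convex G C"
  using assms p3_convex_iff[of G C] by blast

lemma nbrs_sym: "v \<in> verts G \<Longrightarrow> u \<in> nbrs G v \<Longrightarrow> v \<in> nbrs G u"
  by (simp add: nbrs_def insert_commute)

text \<open>
  Irredundance is minimality relative to the hull of \<open>S\<close> itself rather than to the whole vertex
  set, so that it can be carried along while the hull grows.
\<close>

definition irredundant :: "'a graph \<Rightarrow> 'a set \<Rightarrow> bool" where
  "irredundant G S \<longleftrightarrow> S \<subseteq> verts G \<and> (\<forall>u\<in>S. p3_hull G (S - {u}) \<noteq> p3_hull G S)"

lemma irredundant_imp_minimal_hull_set:
  assumes "irredundant G S" "p3_hull G S = verts G"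
  shows "minimal_hull_set G S"
  unfolding minimal_hull_set_def
proof (intro conjI allI impI)
  fix R assume "R \<subset> S"
  then obtain u where u: "u \<in> S" "R \<subseteq> S - {u}" by blast
  have "p3_hull G R \<subseteq> p3_hull G (S - {u})" using u by (intro p3_hull_mono)
  moreover have "p3_hull G (S - {u}) \<subseteq> p3_hull G S" by (intro p3_hull_mono) auto
  moreover have "p3_hull G (S - {u}) \<noteq> p3_hull G S"
    using assms u by (auto simp: irredundant_def)
  ultimately show "p3_hull G R \<subset> verts G" using assms by auto
qed (use assms in \<open>auto simp: irredundant_def\<close>)

lemma caratheodory_set_imp_irredundant: "caratheodory_set G S \<Longrightarrow> irredundant G S"
  by (auto simp: caratheodory_set_def irredundant_def hull_boundary_def)

text \<open>If \<open>u\<close> were generated by the other elements, they would generate all of the hull of \<open>S\<close>.\<close>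

lemma not_in_hull_of_rest:
  assumes "finite (verts G)" "irredundant G S" "u \<in> S"
  shows "u \<notin> p3_hull G (S - {u})"
proof
  assume "u \<in> p3_hull G (S - {u})"
  then have "S \<subseteq> p3_hull G (S - {u})" using subset_p3_hull[of "S - {u}" G] by auto
  moreover have "p3_convex G (p3_hull G (S - {u}))"
    using assms by (intro p3_convex_p3_hull) (auto simp: irredundant_def)
  ultimately have "p3_hull G S \<subseteq> p3_hull G (S - {u})" by (rule p3_hull_subset)
  moreover have "p3_hull G (S - {u}) \<subseteq> p3_hull G S" by (intro p3_hull_mono) auto
  ultimately show False using assms by (auto simp: irredundant_def)
qed

section \<open>Cylinders in Hamming graphs\<close>

locale hamming =
  fixes n :: nat and r :: "nat \<Rightarrow> nat"
  assumes two_le: "\<And>i. i \<in> {1..n} \<Longrightarrow> 2 \<le> r i"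
begin

abbreviation "G \<equiv> hamming_graph n r"
abbreviation "V \<equiv> verts G"
abbreviation "H \<equiv> p3_hull G"

definition cyl :: "nat set \<Rightarrow> (nat \<Rightarrow> nat) \<Rightarrow> (nat \<Rightarrow> nat) set" where
  "cyl I a = {x \<in> V. \<forall>i\<in>I. x i = a i}"

lemma V_eq: "V = (\<Pi>\<^sub>E i\<in>{1..n}. {0..<r i})"
  by (simp add: hamming_graph_def Let_def)

lemma finite_V [simp]: "finite V"
  unfolding V_eq by (intro finite_PiE) auto

lemma V_eqI: "x \<in> V \<Longrightarrow> y \<in> V \<Longrightarrow> (\<And>i. i \<in> {1..n} \<Longrightarrow> x i = y i) \<Longrightarrow> x = y"
  unfolding V_eq by (rule PiE_ext)

lemma upd_V: "x \<in> V \<Longrightarrow> i \<in> {1..n} \<Longrightarrow> c < r i \<Longrightarrow> x(i := c) \<in> V"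
  unfolding V_eq by (auto simp: PiE_iff extensional_def)

lemma V_less: "x \<in> V \<Longrightarrow> i \<in> {1..n} \<Longrightarrow> x i < r i"
  unfolding V_eq by auto

lemma nbrs_eq:
  assumes v: "v \<in> V"
  shows "nbrs G v = {v(i := c) | i c. i \<in> {1..n} \<and> c < r i \<and> c \<noteq> v i}"
proof -
  define D where "D x y = {i \<in> {1..n}. x i \<noteq> y i}" for x y :: "nat \<Rightarrow> nat"
  have edges: "edges G = {{x, y} | x y. x \<in> V \<and> y \<in> V \<and> card (D x y) = 1}"
    by (simp add: hamming_graph_def Let_def D_def)
  have "D x y = D y x" for x y
    by (auto simp: D_def)
  then have E: "{u, v} \<in> edges G \<longleftrightarrow> card (D v u) = 1" if "u \<in> V" for u
    unfolding edges mem_Collect_eq doubleton_eq_iff using that v by metis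
  have "card (D v u) = 1 \<longleftrightarrow>
      (\<exists>i c. u = v(i := c) \<and> i \<in> {1..n} \<and> c < r i \<and> c \<noteq> v i)" (is "?L \<longleftrightarrow> ?R") if u: "u \<in> V" for u
  proof
    assume ?L
    then obtain i where i: "D v u = {i}" by (auto simp: card_1_singleton_iff)
    then have in_i: "i \<in> {1..n}" "v i \<noteq> u i" by (auto simp: D_def)
    have "u = v(i := u i)"
    proof (rule V_eqI[OF u upd_V[OF v in_i(1) V_less[OF u in_i(1)]]])
      fix j assume "j \<in> {1..n}"
      moreover have "j \<in> D v u \<longleftrightarrow> j = i" using i by simp
      ultimately show "u j = (v(i := u i)) j" by (auto simp: D_def)
    qed
    then show ?R using in_i V_less[OF u] by metis
  next
    assume ?R
    then obtain i c where *: "u = v(i := c)" "i \<in> {1..n}" "c \<noteq> v i" by blast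
    then have "D v u = {i}" by (auto simp: D_def)
    then show ?L by simp
  qed
  then have "nbrs G v = {u \<in> V. \<exists>i c. u = v(i := c) \<and> i \<in> {1..n} \<and> c < r i \<and> c \<noteq> v i}"
    using E by (auto simp: nbrs_def)
  also have "\<dots> = {v(i := c) | i c. i \<in> {1..n} \<and> c < r i \<and> c \<noteq> v i}"
    using upd_V[OF v] by auto
  finally show ?thesis .
qed

lemma nbrs_updI:
  "v \<in> V \<Longrightarrow> i \<in> {1..n} \<Longrightarrow> c < r i \<Longrightarrow> c \<noteq> v i \<Longrightarrow> v(i := c) \<in> nbrs G v"
  by (auto simp: nbrs_eq)

lemma nbrsE:
  assumes "y \<in> nbrs G v" "v \<in> V"
  obtains i c where "y = v(i := c)" "i \<in> {1..n}" "c < r i" "c \<noteq> v i"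
  using assms by (auto simp: nbrs_eq)

lemma cyl_subset: "cyl I a \<subseteq> V"
  by (auto simp: cyl_def)

text \<open>
  A vertex outside the cylinder violates some prescribed coordinate \<open>k\<close>; the only neighbour that
  can lie in the cylinder is the one that repairs \<open>k\<close>.
\<close>

lemma cyl_convex: "p3_convex G (cyl I a)"
proof (rule p3_convexI)
  fix v x y
  assume v: "v \<in> V" "v \<notin> cyl I a" and x: "x \<in> nbrs G v" "x \<in> cyl I a"
    and y: "y \<in> nbrs G v" "y \<in> cyl I a" and "x \<noteq> y"
  obtain k where k: "k \<in> I" "v k \<noteq> a k" using v by (auto simp: cyl_def)
  obtain i c where i: "x = v(i := c)" using x v by (auto elim: nbrsE)
  obtain j d where j: "y = v(j := d)" using y v by (auto elim: nbrsE)
  have "x k = a k" "y k = a k" using x y k by (auto simp: cyl_def)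
  then have "i = k" "j = k" "c = a k" "d = a k" using i j k by (auto split: if_splits)
  then show False using \<open>x \<noteq> y\<close> i j by simp
qed (use cyl_subset in auto)

lemma finite_subset_V: "S \<subseteq> V \<Longrightarrow> finite S"
  using finite_V finite_subset by blast

lemma hull_convex: "S \<subseteq> V \<Longrightarrow> p3_convex G (H S)"
  by (simp add: p3_convex_p3_hull)

lemma hull_subset_V: "S \<subseteq> V \<Longrightarrow> H S \<subseteq> V"
  using p3_convex_verts p3_hull_subset by blast

text \<open>
  The layer at height \<open>y i\<close> is filled outwards from \<open>y\<close>: each of its vertices has one neighbour
  below it in the cylinder already present and another one closer to \<open>y\<close>. Any vertex at a third
  height then has its copies in these two layers as neighbours.
\<close>

lemma cyl_span:
  assumes C: "p3_convex G C" and sub: "cyl I a \<subseteq> C" and i: "i \<in> I" "i \<in> {1..n}" "a i < r i"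
    and y: "y \<in> C" "y \<in> cyl (I - {i}) a" "y i \<noteq> a i"
  shows "cyl (I - {i}) a \<subseteq> C"
proof -
  have yV: "y \<in> V" using y by (simp add: cyl_def)
  have base: "z(i := a i) \<in> C" if "z \<in> cyl (I - {i}) a" for z
    using that upd_V[of z i "a i"] i sub by (fastforce simp: cyl_def)
  have layer: "z \<in> C" if "z \<in> cyl (I - {i}) a" "z i = y i" for z
    using that
  proof (induction "card {j \<in> {1..n}. z j \<noteq> y j}" arbitrary: z)
    case 0
    then have "{j \<in> {1..n}. z j \<noteq> y j} = {}" by simp
    then have "z = y" using yV 0 by (intro V_eqI) (auto simp: cyl_def)
    then show ?case using y by simp
  next
    case (Suc m)
    have zV: "z \<in> V" using Suc.prems by (simp add: cyl_def)
    have "{j \<in> {1..n}. z j \<noteq> y j} \<noteq> {}" using Suc.hyps(2) by (metis card.empty nat.distinct(1))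
    then obtain j where j: "j \<in> {1..n}" "z j \<noteq> y j" by blast
    let ?z = "z(j := y j)"
    have ij: "i \<noteq> j" using Suc.prems j by auto
    have "j \<notin> I" using Suc.prems j y(2) ij by (auto simp: cyl_def)
    have "{k \<in> {1..n}. ?z k \<noteq> y k} = {k \<in> {1..n}. z k \<noteq> y k} - {j}" by auto
    then have "card {k \<in> {1..n}. ?z k \<noteq> y k} = m" using Suc.hyps(2) j by simp
    moreover have "?z \<in> cyl (I - {i}) a"
      using Suc.prems \<open>j \<notin> I\<close> upd_V[of z j "y j"] j V_less[OF yV] by (auto simp: cyl_def)
    ultimately have "?z \<in> C" using Suc.hyps(1)[of ?z] Suc.prems ij by auto
    moreover have "?z \<in> nbrs G z" using j V_less[OF yV] zV by (intro nbrs_updI) auto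
    moreover have "z(i := a i) \<in> nbrs G z" using i zV Suc.prems y(3) by (intro nbrs_updI) auto
    moreover have "?z \<noteq> z(i := a i)" using ij j by (auto simp: fun_eq_iff)
    ultimately show ?case using base Suc.prems zV C by (intro p3_convexD[of G C z ?z]) auto
  qed
  show ?thesis
  proof
    fix z assume z: "z \<in> cyl (I - {i}) a"
    then have zV: "z \<in> V" by (simp add: cyl_def)
    show "z \<in> C"
    proof (cases "z i = a i \<or> z i = y i")
      case True
      then show ?thesis using base[OF z] layer[OF z] by (metis fun_upd_triv)
    next
      case False
      have "z(i := y i) \<in> C"
        using z i upd_V[OF zV, of i "y i"] V_less[OF yV] by (intro layer) (auto simp: cyl_def)
      moreover have "z(i := y i) \<in> nbrs G z" "z(i := a i) \<in> nbrs G z"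
        using False i zV V_less[OF yV] by (auto intro!: nbrs_updI)
      moreover have "z(i := y i) \<noteq> z(i := a i)" using y by (auto simp: fun_eq_iff)
      ultimately show ?thesis
        using base[OF z] zV C by (intro p3_convexD[of G C z]) auto
    qed
  qed
qed

text \<open>
  Maximality of the cylinder \<open>?M\<close> through \<open>p\<close> (fewest prescribed coordinates) and \<open>cyl_span\<close>
  show that no vertex of \<open>H F - ?M\<close> is adjacent to \<open>?M\<close>. Hence \<open>H (F \<inter> ?M) \<union> (H F - ?M)\<close> is still
  convex, so \<open>F \<inter> ?M\<close> alone generates \<open>p\<close> and minimality gives \<open>F \<subseteq> ?M\<close>.
\<close>

lemma hull_eq_cyl:
  assumes F: "F \<subseteq> V" and p: "p \<in> H F" and min: "\<And>u. u \<in> F \<Longrightarrow> p \<notin> H (F - {u})"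
  obtains I a where "I \<subseteq> {1..n}" "\<And>i. i \<in> I \<Longrightarrow> a i < r i" "H F = cyl I a"
proof -
  have pV: "p \<in> V" using hull_subset_V[OF F] p by auto
  define P where "P I \<longleftrightarrow> I \<subseteq> {1..n} \<and> cyl I p \<subseteq> H F" for I
  have "cyl {1..n} p = {p}" using pV by (auto simp: cyl_def intro: V_eqI)
  then have "P {1..n}" using p by (simp add: P_def)
  then obtain I where I: "P I" and Imin: "\<And>J. P J \<Longrightarrow> card I \<le> card J"
    using ex_has_least_nat[of P "{1..n}" card] by blast
  let ?M = "cyl I p"
  have In: "I \<subseteq> {1..n}" and MH: "?M \<subseteq> H F" using I by (auto simp: P_def)
  have pM: "p \<in> ?M" using pV by (simp add: cyl_def)
  have iso: "y \<in> ?M" if x: "x \<in> ?M" and y: "y \<in> H F" "y \<in> nbrs G x" for x y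
  proof (rule ccontr)
    assume yM: "y \<notin> ?M"
    have xV: "x \<in> V" using x by (simp add: cyl_def)
    have yV: "y \<in> V" using y hull_subset_V[OF F] by auto
    obtain i c where i: "y = x(i := c)" "i \<in> {1..n}" "c \<noteq> x i"
      using y(2) xV by (auto elim: nbrsE)
    have iI: "i \<in> I" using yM x i yV by (auto simp: cyl_def split: if_splits)
    have "cyl (I - {i}) p \<subseteq> H F"
      using iI i V_less[OF pV] MH y(1) x yV
      by (intro cyl_span[of "H F" I p i y] hull_convex F) (auto simp: cyl_def)
    then have "card I \<le> card (I - {i})" using In by (intro Imin) (auto simp: P_def)
    moreover have "card (I - {i}) < card I"
      using iI In finite_subset[of I "{1..n}"] by (intro psubset_card_mono) auto
    ultimately show False by simp
  qed
  have conv: "p3_convex G (H (F \<inter> ?M) \<union> (H F - ?M))"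
  proof (rule p3_convexI)
    fix v x y
    assume v: "v \<in> V" "v \<notin> H (F \<inter> ?M) \<union> (H F - ?M)"
      and x: "x \<in> nbrs G v" "x \<in> H (F \<inter> ?M) \<union> (H F - ?M)"
      and y: "y \<in> nbrs G v" "y \<in> H (F \<inter> ?M) \<union> (H F - ?M)" and "x \<noteq> y"
    have sub: "H (F \<inter> ?M) \<subseteq> H F" by (intro p3_hull_mono) auto
    then have xy: "x \<in> H F" "y \<in> H F" using x y by auto
    then have "v \<in> H F"
      using v x y \<open>x \<noteq> y\<close> p3_convexD[OF finite_V hull_convex[OF F], of v x y] by auto
    then have "v \<in> ?M" using v by auto
    then have "x \<in> H (F \<inter> ?M)" "y \<in> H (F \<inter> ?M)" using iso xy x y by auto
    then have "v \<in> H (F \<inter> ?M)"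
      using v x y \<open>x \<noteq> y\<close> F
        p3_convexD[OF finite_V hull_convex[of "F \<inter> ?M"], of v x y] by auto
    then show False using v by auto
  qed (use hull_subset_V[OF F] hull_subset_V[of "F \<inter> ?M"] F in auto)
  have "F \<subseteq> H (F \<inter> ?M) \<union> (H F - ?M)"
    using subset_p3_hull[of F G] subset_p3_hull[of "F \<inter> ?M" G] by auto
  then have "p \<in> H (F \<inter> ?M)" using p3_hull_subset[OF _ conv] p pM by auto
  moreover have "p \<notin> H (F \<inter> ?M)" if "u \<in> F" "u \<notin> ?M" for u
    using min[OF that(1)] p3_hull_mono[of "F \<inter> ?M" "F - {u}" G] that by auto
  ultimately have "F \<subseteq> ?M" by auto
  then have "H F \<subseteq> ?M" using cyl_convex by (rule p3_hull_subset)
  then show ?thesis using that[of I p] In MH V_less[OF pV] by blast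
qed

text \<open>
  A coordinate outside \<open>I\<close> takes at least two values on \<open>cyl I a\<close>, so it cannot be prescribed in a
  larger cylinder. This is what makes the dimension of a Hamming subgraph well defined.
\<close>

lemma cyl_subset_determines:
  assumes sub: "cyl I a \<subseteq> cyl J b" and I: "\<And>i. i \<in> I \<Longrightarrow> a i < r i" and I': "I \<subseteq> {1..n}"
    and J: "J \<subseteq> {1..n}"
  shows "J \<subseteq> I"
proof
  fix i assume i: "i \<in> J"
  show "i \<in> I"
  proof (rule ccontr)
    assume iI: "i \<notin> I"
    let ?x = "restrict (\<lambda>j. if j \<in> I then a j else 0) {1..n}"
    have x: "?x \<in> V"
      using two_le I by (fastforce simp: V_eq)
    have upd: "?x(i := c) \<in> cyl I a" if "c < r i" for c
      using upd_V[OF x _ that] I' J i iI by (auto simp: cyl_def)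
    have "2 \<le> r i" using two_le i J by auto
    then have "?x(i := 0) \<in> cyl J b" "?x(i := 1) \<in> cyl J b"
      using upd[of 0] upd[of 1] sub by auto
    then have "(?x(i := 0)) i = b i" "(?x(i := 1)) i = b i"
      using i unfolding cyl_def by blast+
    then show False by simp
  qed
qed

lemma hull_dim_eq:
  assumes HS: "H S = cyl I a" and I: "I \<subseteq> {1..n}" "\<And>i. i \<in> I \<Longrightarrow> a i < r i"
  shows "hull_dim n r S = card ({1..n} - I)"
proof -
  have hs: "hamming_subgraph n r J b = induced_subgraph G (cyl J b)" for J b
    by (simp add: hamming_subgraph_def cyl_def)
  have same: "J = I" if "J \<subseteq> {1..n}" "\<forall>i\<in>J. b i < r i"
    "induced_subgraph G (cyl I a) = induced_subgraph G (cyl J b)" for J b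
  proof -
    have "cyl I a = cyl J b" using that(3) by (simp add: induced_subgraph_def)
    then show ?thesis
      using cyl_subset_determines[of I a J b] cyl_subset_determines[of J b I a] that I by auto
  qed
  show ?thesis
    unfolding hull_dim_def hamming_dim_def HS hs
  proof (rule the_equality)
    show "\<exists>J b. J \<subseteq> {1..n} \<and> (\<forall>i\<in>J. b i < r i) \<and>
      induced_subgraph G (cyl I a) = induced_subgraph G (cyl J b) \<and> card ({1..n} - I) = card ({1..n} - J)"
      using I by blast
  qed (use same in blast)
qed

section \<open>Growing an irredundant set by one coordinate\<close>

text \<open>
  Projecting along coordinate \<open>i\<close> maps each neighbour of \<open>v\<close> to the image of \<open>v\<close> or to a neighbour
  of it, and the first does not happen for a neighbour in the preimage of \<open>K\<close> when \<open>v\<close> is outside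
  that preimage. This bounds from above what a lifted set generates.
\<close>

lemma p3_convex_vimage_upd:
  assumes K: "p3_convex G K" "\<And>x. x \<in> K \<Longrightarrow> x i = c" and i: "i \<in> {1..n}" and c: "c < r i"
  shows "p3_convex G {x \<in> V. x(i := c) \<in> K}"
proof (rule p3_convexI)
  fix v x y
  assume v: "v \<in> V" "v \<notin> {x \<in> V. x(i := c) \<in> K}"
    and x: "x \<in> nbrs G v" "x \<in> {x \<in> V. x(i := c) \<in> K}"
    and y: "y \<in> nbrs G v" "y \<in> {x \<in> V. x(i := c) \<in> K}" and "x \<noteq> y"
  let ?v = "v(i := c)"
  have vV: "?v \<in> V" using v i c by (intro upd_V)
  have notK: "?v \<notin> K" using v by simp
  have proj: "z(i := c) \<in> nbrs G ?v \<and> z i = v i" if z: "z \<in> nbrs G v" "z(i := c) \<in> K" for z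
  proof -
    obtain j d where j: "z = v(j := d)" "j \<in> {1..n}" "d < r j" "d \<noteq> v j"
      using z v by (auto elim: nbrsE)
    have ij: "j \<noteq> i" using j z notK by auto
    then have "z(i := c) = ?v(j := d)" using j by (simp add: fun_upd_twist)
    then show ?thesis using j ij vV nbrs_updI[of ?v j d] by simp
  qed
  have "x(i := c) \<noteq> y(i := c)"
    using proj[of x] proj[of y] x y \<open>x \<noteq> y\<close>
    by (metis (mono_tags, lifting) fun_upd_triv fun_upd_upd mem_Collect_eq)
  then show False
    using p3_convexD[OF finite_V K(1) vV, of "x(i := c)" "y(i := c)"] proj[of x] proj[of y] x y notK
    by auto
qed auto

text \<open>
  The set \<open>T\<close> consists of \<open>u'\<close> and either \<open>S - {u}\<close> or \<open>S\<close>, according to whether \<open>u\<close> has a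
  neighbour in \<open>H (S - {u})\<close>. Merely adding \<open>u'\<close> would not do in the first case, since \<open>u\<close> would
  then be redundant.
\<close>

lemma irredundant_lift:
  assumes S: "irredundant G S" "S \<noteq> {}" "H S = cyl I a"
    and i: "i \<in> I" "i \<in> {1..n}" "a i < r i"
  obtains T where "irredundant G T" "card S \<le> card T" "H T = cyl (I - {i}) a"
proof -
  obtain u where u: "u \<in> S" using S by blast
  define b where "b = (if a i = 0 then 1 else 0 :: nat)"
  have b: "b < r i" "b \<noteq> a i" using two_le[OF i(2)] by (auto simp: b_def)
  define u' where "u' = u(i := b)"
  have SV: "S \<subseteq> V" using S by (simp add: irredundant_def)
  have Scyl: "S \<subseteq> cyl I a" using subset_p3_hull[of S G] S by simp
  have uV: "u \<in> V" and ui: "u i = a i" using u Scyl i by (auto simp: cyl_def)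
  have u'V: "u' \<in> V" using upd_V[OF uV i(2) b(1)] by (simp add: u'_def)
  have u'i: "u' i = b" and u'back: "u'(i := a i) = u"
    using ui by (auto simp: u'_def)
  have u'cyl: "u' \<notin> cyl I a" "u' \<in> cyl (I - {i}) a"
    using u'i b i u Scyl u'V by (auto simp: cyl_def u'_def)
  have u'S: "u' \<notin> S" using u'cyl Scyl by auto
  have sub_layer: "H R \<subseteq> cyl I a" if "R \<subseteq> S" for R
    using p3_hull_mono[OF that, of G] S by simp
  have layer: "x i = a i" if "x \<in> H R" "R \<subseteq> S" for x R
    using sub_layer[OF that(2)] that(1) i by (auto simp: cyl_def)
  have upd_triv: "x(i := a i) = x" if "x \<in> cyl I a" for x
    using that i by (auto simp: cyl_def fun_upd_idem_iff)
  have cyl_mono: "cyl I a \<subseteq> cyl (I - {i}) a" by (auto simp: cyl_def)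
  have hullT: "H T = cyl (I - {i}) a" if T: "T \<subseteq> insert u' S" "u' \<in> T" "S \<subseteq> H T" for T
  proof
    have TV: "T \<subseteq> V" using T u'V SV by auto
    have "T \<subseteq> cyl (I - {i}) a" using T Scyl cyl_mono u'cyl by auto
    then show "H T \<subseteq> cyl (I - {i}) a" using cyl_convex by (rule p3_hull_subset)
    have "cyl I a \<subseteq> H T"
      using p3_hull_subset[OF T(3) hull_convex[OF TV]] S by simp
    moreover have "u' \<in> H T" using T subset_p3_hull[of T G] by auto
    ultimately show "cyl (I - {i}) a \<subseteq> H T"
      using u'cyl u'i b by (intro cyl_span[of "H T" I a i u'] hull_convex TV i) auto
  qed
  have drop_u': "H R \<noteq> cyl (I - {i}) a" if "R \<subseteq> S" for R
    using sub_layer[OF that] u'cyl by auto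
  have drop_w: "H R \<noteq> cyl (I - {i}) a"
    if w: "w \<in> S" "w \<noteq> u" "R \<subseteq> insert u' (S - {w})" for w R
  proof
    assume eq: "H R = cyl (I - {i}) a"
    let ?K = "H (S - {w})"
    have "R \<subseteq> {x \<in> V. x(i := a i) \<in> ?K}"
    proof
      fix x assume "x \<in> R"
      then consider "x = u'" | "x \<in> S - {w}" using w by auto
      then show "x \<in> {x \<in> V. x(i := a i) \<in> ?K}"
      proof cases
        case 1
        then show ?thesis using u'V u'back u w subset_p3_hull[of "S - {w}" G] by auto
      next
        case 2
        then have "x(i := a i) = x" using Scyl by (intro upd_triv) auto
        then show ?thesis using 2 SV subset_p3_hull[of "S - {w}" G] by auto
      qed
    qed
    then have "H R \<subseteq> {x \<in> V. x(i := a i) \<in> ?K}"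
      using layer[of _ "S - {w}"] SV i
      by (intro p3_hull_subset p3_convex_vimage_upd hull_convex) auto
    then have "\<And>x. x \<in> cyl I a \<Longrightarrow> x(i := a i) \<in> ?K"
      using eq cyl_mono by auto
    then have "H S \<subseteq> ?K" using S upd_triv by auto
    then have "w \<in> ?K" using w subset_p3_hull[of S G] by auto
    then show False using not_in_hull_of_rest[OF finite_V S(1) w(1)] by simp
  qed
  show ?thesis
  proof (cases "\<exists>y. y \<in> nbrs G u \<and> y \<in> H (S - {u})")
    case True
    then obtain y where y: "y \<in> nbrs G u" "y \<in> H (S - {u})" by blast
    let ?T = "insert u' (S - {u})"
    have TV: "?T \<subseteq> V" using SV u'V by auto
    have "y \<in> H ?T" using y p3_hull_mono[of "S - {u}" ?T G] by auto
    moreover have "u' \<in> H ?T" using subset_p3_hull[of ?T G] by auto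
    moreover have "u' \<in> nbrs G u" using uV i b ui unfolding u'_def by (intro nbrs_updI) auto
    moreover have "y \<noteq> u'" using layer[OF y(2)] u'i b by auto
    ultimately have "u \<in> H ?T"
      using y uV p3_convexD[OF finite_V hull_convex[OF TV], of u y u'] by auto
    then have "S \<subseteq> H ?T" using subset_p3_hull[of ?T G] by auto
    then have HT: "H ?T = cyl (I - {i}) a" by (intro hullT) auto
    have "H (?T - {w}) \<noteq> cyl (I - {i}) a" if "w \<in> ?T" for w
    proof (cases "w = u'")
      case True
      then show ?thesis by (intro drop_u') auto
    next
      case False
      then show ?thesis using that by (intro drop_w[of w]) auto
    qed
    then have "irredundant G ?T" using HT TV by (auto simp: irredundant_def)
    moreover have "card ?T = card S"
      using u u'S finite_subset_V[OF SV] card_Suc_Diff1[of S u] by simp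
    ultimately show ?thesis using HT that by simp
  next
    case False
    let ?T = "insert u' S"
    have TV: "?T \<subseteq> V" using SV u'V by auto
    have HT: "H ?T = cyl (I - {i}) a"
      using subset_p3_hull[of ?T G] by (intro hullT) auto
    have drop_u: "H (?T - {u}) \<noteq> cyl (I - {i}) a"
    proof -
      let ?K = "H (S - {u})"
      have KV: "?K \<subseteq> V" using SV by (intro hull_subset_V) auto
      have Kconv: "p3_convex G ?K" using SV by (intro hull_convex) auto
      \<comment> \<open>A common neighbour of \<open>u'\<close> and of some \<open>x \<in> ?K\<close> would put \<open>u\<close> in \<open>?K\<close> or next to it.\<close>
      have apart: False if v: "v \<in> V" "v \<notin> insert u' ?K" "u' \<in> nbrs G v" "x \<in> nbrs G v" "x \<in> ?K" for v x
      proof -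
        obtain j d where j: "v = u'(j := d)" "j \<in> {1..n}" "d < r j" "d \<noteq> u' j"
          using nbrsE[OF nbrs_sym[OF v(1,3)] u'V] .
        obtain k e where k: "x = v(k := e)" "k \<in> {1..n}" "e < r k" "e \<noteq> v k"
          using v by (auto elim: nbrsE)
        have xi: "x i = a i" using layer[OF v(5)] by auto
        have "x \<in> nbrs G u \<or> x = u"
        proof (cases "j = i")
          case True
          then have vu: "v = u(i := d)" using j by (simp add: u'_def)
          show ?thesis
          proof (cases "k = i")
            case True
            then have "x = u" using vu k xi ui by auto
            then show ?thesis by simp
          next
            case False
            then have "d = a i" using vu k xi by auto
            then have "v = u" using vu ui by auto
            then show ?thesis using v by simp
          qed
        next
          case ji: False
          then have "v i = b" using j u'i by simp
          then have "k = i" "e = a i" using k xi b by (auto split: if_splits)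
          then have "x = u(j := d)"
            using j k ji ui by (auto simp: u'_def fun_eq_iff)
          moreover have "d \<noteq> u j" using j ji by (simp add: u'_def)
          ultimately show ?thesis using j uV nbrs_updI by simp
        qed
        then show False
          using False v not_in_hull_of_rest[OF finite_V S(1) u] by auto
      qed
      have "p3_convex G (insert u' ?K)"
      proof (rule p3_convexI)
        fix v x y
        assume v: "v \<in> V" "v \<notin> insert u' ?K"
          and x: "x \<in> nbrs G v" "x \<in> insert u' ?K"
          and y: "y \<in> nbrs G v" "y \<in> insert u' ?K" and "x \<noteq> y"
        then show False
          using apart[of v x] apart[of v y] p3_convexD[OF finite_V Kconv, of v x y] by auto
      qed (use KV u'V in auto)
      then have "H (?T - {u}) \<subseteq> insert u' ?K"
        using subset_p3_hull[of "S - {u}" G] by (intro p3_hull_subset) auto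
      moreover have "u \<notin> insert u' ?K"
        using not_in_hull_of_rest[OF finite_V S(1) u] u'S u by auto
      moreover have "u \<in> cyl (I - {i}) a" using u Scyl cyl_mono by auto
      ultimately show ?thesis by auto
    qed
    have "H (?T - {w}) \<noteq> cyl (I - {i}) a" if w: "w \<in> ?T" for w
    proof -
      consider "w = u'" | "w = u" | "w \<in> S" "w \<noteq> u" using w by auto
      then show ?thesis
      proof cases
        case 1
        then show ?thesis by (intro drop_u') auto
      next
        case 3
        then show ?thesis by (intro drop_w[of w]) auto
      qed (use drop_u in simp)
    qed
    then have "irredundant G ?T" using HT TV by (auto simp: irredundant_def)
    moreover have "card S \<le> card ?T"
      using finite_subset_V[OF TV] by (intro card_mono) auto
    ultimately show ?thesis using HT that by simp
  qed
qed

lemma irredundant_extend: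
  assumes "irredundant G S" "S \<noteq> {}" "H S = cyl I a" "I \<subseteq> {1..n}" "\<And>i. i \<in> I \<Longrightarrow> a i < r i"
  shows "\<exists>T. minimal_hull_set G T \<and> card S \<le> card T"
proof -
  have "finite I" using assms(4) finite_subset by blast
  then show ?thesis using assms
  proof (induction I arbitrary: S rule: finite_induct)
    case empty
    then show ?case
      by (intro exI[of _ S]) (auto intro: irredundant_imp_minimal_hull_set simp: cyl_def)
  next
    case (insert i I)
    obtain T where T: "irredundant G T" "card S \<le> card T" "H T = cyl (insert i I - {i}) a"
      using irredundant_lift[of S "insert i I" a i] insert.prems by auto
    have "S \<subseteq> V" using insert.prems by (simp add: irredundant_def)
    then have "card S > 0" using insert.prems finite_subset_V by (simp add: card_gt_0_iff)
    then have "T \<noteq> {}" using T by auto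
    moreover have "insert i I - {i} = I" using insert.hyps by auto
    ultimately obtain T' where "minimal_hull_set G T'" "card T \<le> card T'"
      using insert.IH[of T] T insert.prems by auto
    then show ?case using T(2) le_trans by blast
  qed
qed

text \<open>
  A subset \<open>F\<close> of least cardinality that generates \<open>p\<close> is irredundant, with \<open>p\<close> itself as witness,
  and it grows into a minimal hull set that is at least as large.
\<close>

lemma caratheodory_number_le: "caratheodory_number G \<le> max_minimal_hull_set G"
  unfolding caratheodory_number_def
proof (rule Least_le, intro allI impI)
  fix S p assume S: "S \<subseteq> V" and p: "p \<in> H S"
  obtain F where F: "F \<subseteq> S" "p \<in> H F"
    and Fmin: "\<And>R. R \<subseteq> S \<Longrightarrow> p \<in> H R \<Longrightarrow> card F \<le> card R"
    using ex_has_least_nat[of "\<lambda>F. F \<subseteq> S \<and> p \<in> H F" S card] p by blast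
  have FV: "F \<subseteq> V" using F S by auto
  have rest: "p \<notin> H (F - {u})" if "u \<in> F" for u
    using Fmin[of "F - {u}"] F that card_Diff1_less[OF finite_subset_V[OF FV] that] by auto
  then have irr: "irredundant G F" using F FV by (auto simp: irredundant_def)
  have "F \<noteq> {}" using F p3_hull_empty[of G] by auto
  then obtain T where T: "minimal_hull_set G T" "card F \<le> card T"
    using hull_eq_cyl[OF FV F(2) rest] irredundant_extend[OF irr] by metis
  have "{card T |T. minimal_hull_set G T} \<subseteq> card ` Pow V"
    by (auto simp: minimal_hull_set_def)
  then have "finite {card T |T. minimal_hull_set G T}"
    by (rule finite_subset) simp
  then have "card T \<le> max_minimal_hull_set G"
    unfolding max_minimal_hull_set_def using T by (intro Max_ge) auto
  then show "\<exists>F\<subseteq>S. card F \<le> max_minimal_hull_set G \<and> p \<in> H F"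
    using F T by (intro exI[of _ F]) auto
qed

lemma caratheodory_full_dim:
  assumes S: "caratheodory_set G S" and dim: "hull_dim n r S = n"
  shows "minimal_hull_set G S"
proof -
  obtain p where p: "p \<in> H S" "\<And>u. u \<in> S \<Longrightarrow> p \<notin> H (S - {u})"
    using S by (auto simp: caratheodory_set_def hull_boundary_def)
  have "S \<subseteq> V" using S by (simp add: caratheodory_set_def)
  then obtain I a where I: "I \<subseteq> {1..n}" "\<And>i. i \<in> I \<Longrightarrow> a i < r i" "H S = cyl I a"
    using hull_eq_cyl[OF _ p] by blast
  have "card ({1..n} - I) = n" using hull_dim_eq[OF I(3,1,2)] dim by simp
  then have "{1..n} - I = {1..n}" by (intro card_subset_eq) auto
  then have "I = {}" using I by auto
  then have "H S = V" using I by (simp add: cyl_def)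
  then show ?thesis
    using S by (intro irredundant_imp_minimal_hull_set caratheodory_set_imp_irredundant)
qed

end

theorem mainTheorem4:
  fixes n :: nat and r :: "nat \<Rightarrow> nat"
  assumes "n \<ge> 2"
    and "\<forall>i\<in>{1..n}. r i \<ge> 2"
  shows "(\<forall>S. caratheodory_set (hamming_graph n r) S \<and> hull_dim n r S = n \<and>
            (\<forall>T. caratheodory_set (hamming_graph n r) T \<and> hull_dim n r T = n \<longrightarrow> card T \<le> card S)
            \<longrightarrow> minimal_hull_set (hamming_graph n r) S) \<and>
         caratheodory_number (hamming_graph n r) \<le> max_minimal_hull_set (hamming_graph n r)"
proof -
  interpret hamming n r
    using assms(2) by unfold_locales auto
  show ?thesis
    using caratheodory_full_dim caratheodory_number_le by blast
qed

end
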